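(* Let $f:\mathbb{R}^n\to\mathbb{R}$ be $L$-smooth and $\alpha$-strongly convex ($L,\alpha>0$), let $\Psi:\mathbb{R}^n\to\mathbb{R}\cup\{+\infty\}$ be closed, proper and convex, let $F=f+\Psi$, and let $\mathbf{x}^*$ be the minimizer of $F$. Let $\{\mathbf{x}_k,\mathbf{z}_k,\mathbf{y}_k\}_{k\ge 1}$ be generated by the idealized algorithm described in the context, and define, for $k\ge1$, $$\Phi_k=\|\mathbf{y}_k-\mathbf{x}^*\|^2+\frac{2(F(\mathbf{x}_k)-F(\mathbf{x}^* ))}{\alpha}.$$ Then for every $k=1,2,\ldots$, $$\Phi_{k+1}\le\left(1-\sqrt{\frac{\alpha}{L}}\right)\Phi_k .$$
   Context: $f$ is $L$-smooth if it is differentiable and $|f(\mathbf{x})-f(\mathbf{y})-\nabla f(\mathbf{y})^T(\mathbf{x}-\mathbf{y})|\le (L/2)\|\mathbf{x}-\mathbf{y}\|^2$ for all $\mathbf{x},\mathbf{y}$; $f$ is $\alpha$-strongly convex if $f(\mathbf{y})\ge f(\mathbf{x})+\nabla f(\mathbf{x})^T(\mathbf{y}-\mathbf{x})+(\alpha/2)\|\mathbf{x}-\mathbf{y}\|^2$ for all $\mathbf{x},\mathbf{y}$. For $t>0$, $\mathrm{prox}_{t\Psi}(\mathbf{x})=\operatorname{argmin}_{\mathbf{z}}\{\Psi(\mathbf{z})+\|\mathbf{x}-\mathbf{z}\|^2/(2t)\}$, and the prox-gradient mapping is $G_t(\mathbf{x})=t^{-1}(\mathbf{x}-\mathrm{prox}_{t\Psi}(\mathbf{x}-t\nabla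 f(\mathbf{x})))$. Idealized algorithm (strongly convex case). Fix $\mathbf{x}_0\in\mathbb{R}^n$, set $\mathbf{z}_0=\mathbf{x}_0$, and let $\mathcal{M}_1$ be any affine subspace containing $\mathbf{z}_0+\mathrm{span}\{G_{1/L}(\mathbf{z}_0)\}$. For $k=1,2,\ldots$: (1) $\mathbf{y}_k=\operatorname{argmin}\{\|\mathbf{y}-\mathbf{x}^*\|^2:\mathbf{y}\in\mathcal{M}_k\}$. (2) $\mathbf{x}_k=\operatorname{argmin}\{F(\mathbf{x}):\mathbf{x}\in\mathcal{M}_k\}$. (3) $\mathbf{z}_k$ is any point of $\mathcal{M}_k$ with $G_{1/L}(\mathbf{z}_k)^T(\mathbf{y}_k-\mathbf{z}_k)\ge0$ and $F(\bar{\mathbf{z}}_k)\le F(\mathbf{x}_k)-\frac{1}{2L}\|G_{1/L}(\mathbf{z}_k)\|^2$, where $\bar{\mathbf{z}}_k=\mathbf{z}_k-\frac1L G_{1/L}(\mathbf{z}_k)$. (4) $\mathcal{M}_{k+1}$ is any affine subspace containing $\mathbf{z}_k+\mathrm{span}\{\mathbf{y}_k-\mathbf{z}_k,\,G_{1/L}(\mathbf{z}_k)\}$. *)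

theory Defs
  imports "HOL-Analysis.Analysis"
begin

definition grad :: "('a::real_inner \<Rightarrow> real) \<Rightarrow> 'a \<Rightarrow> 'a" where
  "grad f x = (THE D. GDERIV f x :> D)"

definition L_smooth :: "real \<Rightarrow> ('a::real_inner \<Rightarrow> real) \<Rightarrow> bool" where
  "L_smooth L f \<longleftrightarrow>
     (\<forall>x. f differentiable (at x)) \<and>
     (\<forall>x y. \<bar>f x - f y - grad f y \<bullet> (x - y)\<bar> \<le> (L / 2) * (norm (x - y))\<^sup>2)"

definition strongly_convex :: "real \<Rightarrow> ('a::real_inner \<Rightarrow> real) \<Rightarrow> bool" where
  "strongly_convex \<alpha> f \<longleftrightarrow>
     (\<forall>x y. f y \<ge> f x + grad f x \<bullet> (y - x) + (\<alpha> / 2) * (norm (x - y))\<^sup>2)"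

text \<open>
  A function into the reals extended by plus infinity is an \<^typ>\<open>ereal\<close>-valued function that
  never takes the value minus infinity; the latter is part of \<open>proper_fun\<close>.
  Closedness and convexity are those of the epigraph (a subset of the product with the reals;
  the library's \<open>epigraph\<close> and \<open>convex_on\<close> cover real-valued functions only).
\<close>

definition epi :: "('a \<Rightarrow> ereal) \<Rightarrow> ('a \<times> real) set" where
  "epi \<Psi> = {(x, r). \<Psi> x \<le> ereal r}"

definition proper_fun :: "('a \<Rightarrow> ereal) \<Rightarrow> bool" where
  "proper_fun \<Psi> \<longleftrightarrow> (\<forall>x. \<Psi> x \<noteq> -\<infinity>) \<and> (\<exists>x. \<Psi> x \<noteq> \<infinity>)"

definition closed_fun :: "('a::topological_space \<Rightarrow> ereal) \<Rightarrow> bool" where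
  "closed_fun \<Psi> \<longleftrightarrow> closed (epi \<Psi>)"

definition convex_fun :: "('a::real_vector \<Rightarrow> ereal) \<Rightarrow> bool" where
  "convex_fun \<Psi> \<longleftrightarrow> convex (epi \<Psi>)"

definition composite :: "('a \<Rightarrow> real) \<Rightarrow> ('a \<Rightarrow> ereal) \<Rightarrow> 'a \<Rightarrow> ereal" where
  "composite f \<Psi> x = ereal (f x) + \<Psi> x"

definition prox :: "real \<Rightarrow> ('a::real_normed_vector \<Rightarrow> ereal) \<Rightarrow> 'a \<Rightarrow> 'a" where
  "prox t \<Psi> x = (ARG_MIN (\<lambda>z. \<Psi> z + ereal ((norm (x - z))\<^sup>2 / (2 * t))) z. True)"

definition prox_grad ::
  "real \<Rightarrow> ('a::real_inner \<Rightarrow> real) \<Rightarrow> ('a \<Rightarrow> ereal) \<Rightarrow> 'a \<Rightarrow> 'a" where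
  "prox_grad t f \<Psi> x = (1 / t) *\<^sub>R (x - prox t \<Psi> (x - t *\<^sub>R grad f x))"

text \<open>
  The sequences produced by the idealized algorithm, as a relation since the subspaces \<open>M k\<close>
  and the points \<open>z k\<close> are chosen freely subject to the stated constraints.
  \<open>M 0\<close> and \<open>y 0\<close> are unused.
\<close>

definition idealized_algorithm ::
  "real \<Rightarrow> ('a::real_inner \<Rightarrow> real) \<Rightarrow> ('a \<Rightarrow> ereal) \<Rightarrow> 'a \<Rightarrow>
   (nat \<Rightarrow> 'a set) \<Rightarrow> (nat \<Rightarrow> 'a) \<Rightarrow> (nat \<Rightarrow> 'a) \<Rightarrow> (nat \<Rightarrow> 'a) \<Rightarrow> bool" where
  "idealized_algorithm L f \<Psi> xstar M x z y \<longleftrightarrow>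
     (let F = composite f \<Psi>; G = prox_grad (1 / L) f \<Psi> in
       z 0 = x 0 \<and>
       affine (M 1) \<and> (+) (z 0) ` span {G (z 0)} \<subseteq> M 1 \<and>
       (\<forall>k\<ge>1.
          is_arg_min (\<lambda>v. (norm (v - xstar))\<^sup>2) (\<lambda>v. v \<in> M k) (y k) \<and>
          is_arg_min F (\<lambda>v. v \<in> M k) (x k) \<and>
          z k \<in> M k \<and>
          G (z k) \<bullet> (y k - z k) \<ge> 0 \<and>
          F (z k - (1 / L) *\<^sub>R G (z k)) \<le> F (x k) - ereal (1 / (2 * L) * (norm (G (z k)))\<^sup>2) \<and>
          affine (M (k + 1)) \<and>
          (+) (z k) ` span {y k - z k, G (z k)} \<subseteq> M (k + 1)))"

definition potential ::
  "real \<Rightarrow> ('a::real_normed_vector \<Rightarrow> ereal) \<Rightarrow> 'a \<Rightarrow>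
   (nat \<Rightarrow> 'a) \<Rightarrow> (nat \<Rightarrow> 'a) \<Rightarrow> nat \<Rightarrow> ereal" where
  "potential \<alpha> F xstar x y k =
     ereal ((norm (y k - xstar))\<^sup>2) + 2 * (F (x k) - F xstar) / ereal \<alpha>"

end

theory Submission imports Defs begin

text \<open>
  Write \<open>G = G\<^bsub>1/L\<^esub>(z\<^sub>k)\<close>, \<open>q = sqrt (\<alpha> / L)\<close> and let \<open>v = z\<^sub>k - G / L\<close>. Optimality of the proximal point
  \<open>v\<close> gives the affine minorant of \<open>\<Psi>\<close> with slope \<open>G - \<nabla>f(z\<^sub>k)\<close>; together with strong convexity and
  smoothness of \<open>f\<close> it yields
  \<open>F(u) \<ge> F(v) + G \<bullet> (u - z\<^sub>k) + |G|\<^sup>2 / (2L) + (\<alpha>/2) |u - z\<^sub>k|\<^sup>2\<close> for every \<open>u\<close>.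
  The subspace \<open>M\<^sub>k\<^sub>+\<^sub>1\<close> contains both \<open>v\<close> and
  \<open>w = (1 - q) y\<^sub>k + q z\<^sub>k - (q / \<alpha>) G\<close>; comparing \<open>x\<^sub>k\<^sub>+\<^sub>1\<close> with \<open>v\<close> and \<open>y\<^sub>k\<^sub>+\<^sub>1\<close> with \<open>w\<close>, and using the
  inequality above at \<open>u = x\<^sup>*\<close>, gives the contraction.
\<close>

section \<open>Subgradients of \<Psi> and existence of proximal points\<close>

text \<open>Along the segment from \<open>p\<close> to \<open>u\<close>, convexity of the epigraph
  bounds \<Psi> linearly in \<open>t\<close>, while the quadratic term of the bound on
  \<open>h\<close> is of order \<open>t^2\<close>. Dividing by \<open>t\<close> and letting
  \<open>t\<close> tend to 0 shows that \<open>- g\<close> is a subgradient of \<Psi> at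
  \<open>p\<close>.\<close>

lemma convex_fun_minimizer_minorant:
  fixes \<Psi> :: "'a::real_inner \<Rightarrow> ereal"
  assumes conv: "convex_fun \<Psi>"
    and p: "\<Psi> p = ereal a"
    and min: "\<And>u. ereal (h p) + \<Psi> p \<le> ereal (h u) + \<Psi> u"
    and h: "\<And>u. h u \<le> h p + g \<bullet> (u - p) + C * (norm (u - p))\<^sup>2"
    and u: "\<Psi> u \<le> ereal b"
  shows "a \<le> b + g \<bullet> (u - p)"
proof -
  let ?s = "b - a + g \<bullet> (u - p)" and ?n = "C * (norm (u - p))\<^sup>2"
  have *: "0 \<le> ?s + t * ?n" if t: "0 < t" "t < 1" for t
  proof -
    let ?w = "(1 - t) *\<^sub>R p + t *\<^sub>R u"
    have "(p, a) \<in> epi \<Psi>" "(u, b) \<in> epi \<Psi>"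
      using p u by (auto simp: epi_def)
    then have "(1 - t) *\<^sub>R (p, a) + t *\<^sub>R (u, b) \<in> epi \<Psi>"
      using conv t unfolding convex_fun_def by (intro convexD) auto
    then have "\<Psi> ?w \<le> ereal ((1 - t) * a + t * b)"
      by (simp add: epi_def)
    then have "ereal (h p) + \<Psi> p \<le> ereal (h ?w) + ereal ((1 - t) * a + t * b)"
      by (meson add_left_mono min order_trans)
    then have "h p + a \<le> h ?w + ((1 - t) * a + t * b)"
      by (simp add: p)
    moreover have "?w - p = t *\<^sub>R (u - p)"
      by (simp add: algebra_simps)
    then have "h ?w \<le> h p + t * (g \<bullet> (u - p)) + C * (t * norm (u - p))\<^sup>2"
      using h[of ?w] t by simp
    ultimately have "0 \<le> t * (?s + t * ?n)"
      by (simp add: algebra_simps power2_eq_square)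
    then show ?thesis
      using t by (simp add: zero_le_mult_iff)
  qed
  have "((\<lambda>t. ?s + t * ?n) \<longlongrightarrow> ?s + 0 * ?n) (at_right 0)"
    by (intro tendsto_intros)
  moreover have "eventually (\<lambda>t. 0 \<le> ?s + t * ?n) (at_right 0)"
    using * by (auto simp: eventually_at_right[of 0 1] intro!: exI[of _ 1])
  ultimately have "0 \<le> ?s + 0 * ?n"
    by (rule tendsto_lowerbound) simp
  then show ?thesis by simp
qed

text \<open>\<open>prox\<close> is a choice operator, so its minimality rests on the existence of
  some minimizer. The affine minorant makes the proximal objective coercive, and minimizing the
  continuous \<open>\<phi>\<close> over the closed epigraph takes the place of a semicontinuity
  argument.\<close>

lemma prox_attained:
  fixes \<Psi> :: "'a::euclidean_space \<Rightarrow> ereal"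
  assumes clo: "closed_fun \<Psi>" and proper: "proper_fun \<Psi>"
    and p: "\<Psi> p = ereal a"
    and minor: "\<And>u b. \<Psi> u \<le> ereal b \<Longrightarrow> a \<le> b + g \<bullet> (u - p)"
    and t: "t > 0"
  obtains r where "\<Psi> (prox t \<Psi> x) = ereal r"
    and "\<And>u. ereal ((norm (x - prox t \<Psi> x))\<^sup>2 / (2 * t)) + \<Psi> (prox t \<Psi> x)
              \<le> ereal ((norm (x - u))\<^sup>2 / (2 * t)) + \<Psi> u"
proof -
  let ?Q = "\<lambda>z. \<Psi> z + ereal ((norm (x - z))\<^sup>2 / (2 * t))"
  define \<phi> where "\<phi> = (\<lambda>(z, r). r + (norm (x - z))\<^sup>2 / (2 * t))"
  define K where "K = epi \<Psi> \<inter> {w. \<phi> w \<le> \<phi> (p, a)}"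
  \<comment> \<open>The estimate \<open>|g| d <= d^2 / (4 t) + t |g|^2\<close> absorbs the linear
    term of the minorant into half of the proximal quadratic; \<open>D\<close> is the resulting
    bound on the squared distance to \<open>x\<close> over \<open>K\<close>.\<close>
  define D where "D = 4 * t * (\<phi> (p, a) - a + norm g * norm (x - p) + t * (norm g)\<^sup>2)"
  have cont: "continuous_on A \<phi>" for A
    unfolding \<phi>_def case_prod_beta by (intro continuous_intros) (use t in auto)
  have "closed K"
    using clo unfolding K_def closed_fun_def
    by (intro closed_Int closed_Collect_le cont continuous_on_const)
  moreover have "K \<subseteq> cball x (sqrt D) \<times> {a - norm g * (sqrt D + norm (x - p)) .. \<phi> (p, a)}"
  proof
    fix w assume "w \<in> K"
    then obtain z r where w: "w = (z, r)" and zr: "\<Psi> z \<le> ereal r"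
      and le: "r + (norm (x - z))\<^sup>2 / (2 * t) \<le> \<phi> (p, a)"
      by (cases w) (auto simp: K_def epi_def \<phi>_def)
    let ?d = "norm (x - z)"
    have "g \<bullet> (z - p) \<le> norm g * norm (z - p)"
      by (rule norm_cauchy_schwarz)
    also have "\<dots> \<le> norm g * (?d + norm (x - p))"
      by (intro mult_left_mono) (use norm_triangle_ineq4[of "x - p" "x - z"] in auto)
    finally have r: "r \<ge> a - norm g * (?d + norm (x - p))"
      using minor[OF zr] by simp
    have "0 \<le> (?d - 2 * t * norm g)\<^sup>2"
      by simp
    then have "norm g * ?d \<le> ?d\<^sup>2 / (4 * t) + t * (norm g)\<^sup>2"
      using t by (simp add: field_simps power2_eq_square)
    with r le have "?d\<^sup>2 / (2 * t) - ?d\<^sup>2 / (4 * t)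
        \<le> \<phi> (p, a) - a + norm g * norm (x - p) + t * (norm g)\<^sup>2"
      by (simp add: algebra_simps)
    then have "?d\<^sup>2 \<le> D"
      using t by (simp add: D_def field_simps)
    then have d: "?d \<le> sqrt D"
      by (rule real_le_rsqrt)
    then have "norm g * (?d + norm (x - p)) \<le> norm g * (sqrt D + norm (x - p))"
      by (intro mult_left_mono) auto
    moreover have "r \<le> \<phi> (p, a)"
      using le t by (smt (verit) divide_nonneg_pos zero_le_power2)
    ultimately show "w \<in> cball x (sqrt D) \<times> {a - norm g * (sqrt D + norm (x - p)) .. \<phi> (p, a)}"
      using d r by (auto simp: w dist_norm)
  qed
  then have "bounded K"
    by (rule bounded_subset[rotated]) (intro bounded_Times bounded_cball bounded_closed_interval)
  ultimately have "compact K"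
    by (simp add: compact_eq_bounded_closed)
  moreover have pK: "(p, a) \<in> K"
    by (simp add: K_def epi_def p)
  ultimately obtain w where wK: "w \<in> K" and wmin: "\<And>v. v \<in> K \<Longrightarrow> \<phi> w \<le> \<phi> v"
    using continuous_attains_inf[OF _ _ cont] by (metis empty_iff)
  obtain z0 r0 where w: "w = (z0, r0)" by (cases w)
  \<comment> \<open>Epigraph points outside \<open>K\<close> exceed the level
    \<open>\<phi> (p, a)\<close>, which is attained in \<open>K\<close>.\<close>
  have wmin': "\<phi> w \<le> \<phi> v" if "v \<in> epi \<Psi>" for v
    using wmin[of v] wmin[OF pK] that by (cases "\<phi> v \<le> \<phi> (p, a)") (auto simp: K_def)
  have "?Q z0 \<le> ?Q u" for u
  proof (cases "\<Psi> u")
    case (real b)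
    have "?Q z0 \<le> ereal r0 + ereal ((norm (x - z0))\<^sup>2 / (2 * t))"
      using wK by (intro add_right_mono) (simp add: K_def epi_def w)
    also have "\<dots> \<le> ?Q u"
      using wmin'[of "(u, b)"] by (simp add: epi_def w \<phi>_def real)
    finally show ?thesis .
  qed (use proper in \<open>auto simp: proper_fun_def\<close>)
  then have "is_arg_min ?Q (\<lambda>_. True) z0"
    by (simp add: is_arg_min_linorder)
  then have "is_arg_min ?Q (\<lambda>_. True) (prox t \<Psi> x)"
    unfolding prox_def arg_min_def by (rule someI)
  then have opt: "?Q (prox t \<Psi> x) \<le> ?Q u" for u
    by (simp add: is_arg_min_linorder)
  have "\<Psi> (prox t \<Psi> x) \<noteq> \<infinity>"
    using opt[of p] by (auto simp: p)
  moreover have "\<Psi> (prox t \<Psi> x) \<noteq> -\<infinity>"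
    using proper by (simp add: proper_fun_def)
  ultimately obtain r where "\<Psi> (prox t \<Psi> x) = ereal r"
    by (cases "\<Psi> (prox t \<Psi> x)") auto
  then show thesis
    using opt by (intro that) (auto simp: add.commute)
qed

section \<open>The prox-gradient inequality\<close>

lemma prox_grad_inequality:
  fixes \<Psi> :: "'a::euclidean_space \<Rightarrow> ereal"
  assumes L: "L > 0" and smooth: "L_smooth L f" and strong: "strongly_convex \<alpha> f"
    and clo: "closed_fun \<Psi>" and proper: "proper_fun \<Psi>" and conv: "convex_fun \<Psi>"
    and xmin: "is_arg_min (composite f \<Psi>) (\<lambda>_. True) xstar"
    and G: "G = prox_grad (1 / L) f \<Psi> z"
  obtains c where "composite f \<Psi> (z - (1 / L) *\<^sub>R G) = ereal c"
    and "\<And>u b. composite f \<Psi> u = ereal b \<Longrightarrow>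
           c + G \<bullet> (u - z) + (norm G)\<^sup>2 / (2 * L) + \<alpha> / 2 * (norm (u - z))\<^sup>2 \<le> b"
proof -
  have upper: "f u \<le> f v + grad f v \<bullet> (u - v) + L / 2 * (norm (u - v))\<^sup>2" for u v
  proof -
    have "\<bar>f u - f v - grad f v \<bullet> (u - v)\<bar> \<le> L / 2 * (norm (u - v))\<^sup>2"
      using smooth by (auto simp: L_smooth_def)
    then show ?thesis by linarith
  qed
  have Fmin: "ereal (f xstar) + \<Psi> xstar \<le> ereal (f u) + \<Psi> u" for u
    using xmin by (simp add: is_arg_min_linorder composite_def)
  obtain u0 where "\<Psi> u0 \<noteq> \<infinity>"
    using proper by (auto simp: proper_fun_def)
  then have "\<Psi> xstar \<noteq> \<infinity>"
    using Fmin[of u0] by auto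
  moreover have "\<Psi> xstar \<noteq> -\<infinity>"
    using proper by (simp add: proper_fun_def)
  ultimately obtain a where a: "\<Psi> xstar = ereal a"
    by (cases "\<Psi> xstar") auto
  define s where "s = z - (1 / L) *\<^sub>R grad f z"
  define v where "v = prox (1 / L) \<Psi> s"
  have v: "v = z - (1 / L) *\<^sub>R G"
    using L by (simp add: v_def G prox_grad_def s_def)
  \<comment> \<open>The minimizer of the composite supplies the affine minorant needed for
    existence: the quadratic upper bound on \<open>f\<close> at \<open>xstar\<close> makes
    \<open>- grad f xstar\<close> a subgradient of \<Psi> there.\<close>
  have "\<exists>r. \<Psi> v = ereal r \<and> (\<forall>u. ereal ((norm (s - v))\<^sup>2 / (2 * (1 / L))) + \<Psi> v
              \<le> ereal ((norm (s - u))\<^sup>2 / (2 * (1 / L))) + \<Psi> u)"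
    unfolding v_def
    using prox_attained[OF clo proper a convex_fun_minimizer_minorant[OF conv a Fmin upper]] L
    by (metis zero_less_divide_1_iff)
  then obtain r where r: "\<Psi> v = ereal r"
    and vmin: "\<And>u. ereal ((norm (s - v))\<^sup>2 / (2 * (1 / L))) + \<Psi> v
              \<le> ereal ((norm (s - u))\<^sup>2 / (2 * (1 / L))) + \<Psi> u" by blast
  \<comment> \<open>An exact expansion, weakened to an inequality to fit the minorant lemma at
    \<open>v\<close>; the slope is the gradient at \<open>v\<close> of the proximal
    quadratic.\<close>
  have quad: "(norm (s - u))\<^sup>2 / (2 * (1 / L)) \<le>
     (norm (s - v))\<^sup>2 / (2 * (1 / L)) + (L *\<^sub>R (v - s)) \<bullet> (u - v) + L / 2 * (norm (u - v))\<^sup>2" for u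
  proof -
    have "(norm (s - u))\<^sup>2 = (norm (s - v))\<^sup>2 + 2 * ((v - s) \<bullet> (u - v)) + (norm (u - v))\<^sup>2"
      by (simp add: power2_norm_eq_inner algebra_simps inner_commute)
    then have "L / 2 * (norm (s - u))\<^sup>2 =
        L / 2 * ((norm (s - v))\<^sup>2 + 2 * ((v - s) \<bullet> (u - v)) + (norm (u - v))\<^sup>2)"
      by simp
    then show ?thesis
      by (simp add: distrib_left mult.commute)
  qed
  have slope: "L *\<^sub>R (v - s) = grad f z - G"
    using L by (simp add: v s_def algebra_simps)
  have sub: "r \<le> b + (grad f z - G) \<bullet> (u - v)" if "\<Psi> u \<le> ereal b" for u b
    using convex_fun_minimizer_minorant[OF conv r vmin quad that] by (simp only: slope)
  have ineq: "f v + r + G \<bullet> (u - z) + (norm G)\<^sup>2 / (2 * L) + \<alpha> / 2 * (norm (u - z))\<^sup>2 \<le> b"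
    if "composite f \<Psi> u = ereal b" for u b
  proof -
    have "\<Psi> u = ereal (b - f u)"
      using that by (cases "\<Psi> u") (auto simp: composite_def)
    then have 1: "r \<le> b - f u + (grad f z - G) \<bullet> (u - v)"
      by (intro sub) simp
    have 2: "f u \<ge> f z + grad f z \<bullet> (u - z) + \<alpha> / 2 * (norm (u - z))\<^sup>2"
      using strong unfolding strongly_convex_def norm_minus_commute[of u z] by blast
    have 3: "f v \<le> f z + grad f z \<bullet> (v - z) + (norm G)\<^sup>2 / (2 * L)"
      using upper[of v z] L by (simp add: v power_divide power2_eq_square)
    \<comment> \<open>Here \<open>G \<bullet> (v - z) = - |G|^2 / L\<close> yields a gain of
      \<open>|G|^2 / L\<close>; the smoothness bound at \<open>v\<close> costs half of it, leaving
      the coefficient \<open>1 / (2 L)\<close>.\<close>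
    have 4: "(grad f z - G) \<bullet> (u - v) = grad f z \<bullet> (u - z) - grad f z \<bullet> (v - z) - G \<bullet> (u - z)
        - (norm G)\<^sup>2 / L"
      using L by (simp add: v power2_norm_eq_inner algebra_simps)
    have "(norm G)\<^sup>2 / L = 2 * ((norm G)\<^sup>2 / (2 * L))"
      by simp
    with 1 2 3 4 show ?thesis by linarith
  qed
  show thesis
    using that[of "f v + r"] ineq r v by (simp add: composite_def)
qed

section \<open>One contraction step in real arithmetic\<close>

text \<open>At a unit vector both quadratic bounds apply to the same first-order remainder. This
  makes \<open>1 - q\<close> a valid convex weight.\<close>

lemma strong_convexity_le_smoothness:
  fixes f :: "'a::euclidean_space \<Rightarrow> real"
  assumes "L_smooth L f" and "strongly_convex \<alpha> f"
  shows "\<alpha> \<le> L"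
proof -
  obtain e :: 'a where e: "norm e = 1"
    by (metis SOME_Basis norm_Basis)
  have "f e - f 0 - grad f 0 \<bullet> (e - 0) \<le> L / 2 * (norm (e - 0))\<^sup>2"
    using assms(1) unfolding L_smooth_def by (meson abs_le_D1)
  moreover have "f e \<ge> f 0 + grad f 0 \<bullet> (e - 0) + \<alpha> / 2 * (norm (0 - e))\<^sup>2"
    using assms(2) unfolding strongly_convex_def by blast
  ultimately show ?thesis
    by (simp add: e)
qed

text \<open>To be read with \<open>p\<close> the minimizer, \<open>m\<close> its value,
  \<open>b\<close> the value at \<open>x k\<close> and \<open>c\<close> the value at the
  prox-gradient point. The choice of \<open>q\<close> makes the squared length of
  \<open>(q / \<alpha>) G\<close> equal to \<open>|G|^2 / (\<alpha> L)\<close>, that is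
  \<open>2 e\<close>.\<close>

lemma potential_step:
  fixes G p y z :: "'a::real_inner"
  assumes \<alpha>: "\<alpha> > 0" and L: "L > 0" and q: "q\<^sup>2 = \<alpha> / L" "0 \<le> q" "q \<le> 1"
    and inner: "G \<bullet> (y - z) \<ge> 0"
    and prox: "c + G \<bullet> (p - z) + (norm G)\<^sup>2 / (2 * L) + \<alpha> / 2 * (norm (p - z))\<^sup>2 \<le> m"
    and dec: "c \<le> b - (norm G)\<^sup>2 / (2 * L)"
  shows "(norm (z + (1 - q) *\<^sub>R (y - z) - (q / \<alpha>) *\<^sub>R G - p))\<^sup>2 + 2 * (c - m) / \<alpha>
          \<le> (1 - q) * ((norm (y - p))\<^sup>2 + 2 * (b - m) / \<alpha>)"
proof -
  define Y Z where "Y = y - p" and "Z = z - p"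
  define e h where "e = (norm G)\<^sup>2 / (2 * L) / \<alpha>" and "h = (c - m) / \<alpha>"
  define k where "k = q / \<alpha>"
  let ?N = "(norm G)\<^sup>2"
  have eq: "z + (1 - q) *\<^sub>R (y - z) - (q / \<alpha>) *\<^sub>R G - p = (1 - q) *\<^sub>R Y + q *\<^sub>R Z - k *\<^sub>R G"
    by (simp add: Y_def Z_def k_def algebra_simps)
  have "(norm ((1 - q) *\<^sub>R Y + q *\<^sub>R Z))\<^sup>2 =
      (1 - q) * (norm Y)\<^sup>2 + q * (norm Z)\<^sup>2 - q * (1 - q) * (norm (Y - Z))\<^sup>2"
    by (simp add: power2_norm_eq_inner algebra_simps inner_commute)
  then have jensen: "(norm ((1 - q) *\<^sub>R Y + q *\<^sub>R Z))\<^sup>2 \<le> (1 - q) * (norm Y)\<^sup>2 + q * (norm Z)\<^sup>2"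
    using q by simp
  have expand: "(norm (A - k *\<^sub>R G))\<^sup>2 = (norm A)\<^sup>2 - 2 * k * (G \<bullet> A) + k\<^sup>2 * ?N" for A
    unfolding power2_norm_eq_inner
    by (simp add: inner_diff_left inner_diff_right inner_commute power2_eq_square)
  \<comment> \<open>The convex combination is \<open>Z + (1 - q) (Y - Z)\<close> with
    \<open>Y - Z = y - z\<close>: the sign hypothesis controls one part, the prox-gradient
    inequality the other.\<close>
  have split: "G \<bullet> ((1 - q) *\<^sub>R Y + q *\<^sub>R Z) = (1 - q) * (G \<bullet> (y - z)) + G \<bullet> Z"
    by (simp add: Y_def Z_def algebra_simps)
  have "2 * (h + e) + (norm Z)\<^sup>2 \<le> 2 * ((G \<bullet> Z) / \<alpha>)"
  proof -
    have "norm (p - z) = norm Z" "G \<bullet> (p - z) = - (G \<bullet> Z)"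
      by (simp_all add: Z_def norm_minus_commute inner_diff_right)
    then have "(c - m + ?N / (2 * L) + \<alpha> / 2 * (norm Z)\<^sup>2) / \<alpha> \<le> (G \<bullet> Z) / \<alpha>"
      using prox \<alpha> by (intro divide_right_mono) auto
    then have "h + e + (norm Z)\<^sup>2 / 2 \<le> (G \<bullet> Z) / \<alpha>"
      using \<alpha> by (simp add: e_def h_def add_divide_distrib)
    then show ?thesis
      by argo
  qed
  from mult_left_mono[OF this q(2)]
  have gap: "2 * (q * (h + e)) + q * (norm Z)\<^sup>2 \<le> 2 * (k * (G \<bullet> Z))"
    by (simp add: k_def algebra_simps)
  have cross: "0 \<le> k * ((1 - q) * (G \<bullet> (y - z)))"
    using q \<alpha> inner by (simp add: k_def)
  have square: "k\<^sup>2 * ?N = 2 * e"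
    using \<alpha> L q(1) by (simp add: e_def k_def power_divide field_simps power2_eq_square)
  have height: "2 * (c - m) / \<alpha> = 2 * h"
    by (simp add: h_def)
  \<comment> \<open>The term \<open>q |Z|^2\<close> from convexity cancels against
    \<open>gap\<close>. Beyond \<open>(1 - q) |Y|^2\<close> there remains
    \<open>2 (1 - q) (h + e)\<close>, and \<open>dec\<close> bounds \<open>h + e\<close> by
    \<open>(b - m) / \<alpha>\<close>.\<close>
  have "(norm ((1 - q) *\<^sub>R Y + q *\<^sub>R Z - k *\<^sub>R G))\<^sup>2 + 2 * (c - m) / \<alpha>
      \<le> (1 - q) * (norm Y)\<^sup>2 - 2 * (q * (h + e)) + 2 * e + 2 * h"
    using jensen gap cross unfolding expand split height square distrib_left[of k] mult.assoc[of 2]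
    by argo
  also have "\<dots> = (1 - q) * (norm Y)\<^sup>2 + 2 * (1 - q) * ((c - m + ?N / (2 * L)) / \<alpha>)"
    unfolding add_divide_distrib e_def[symmetric] h_def[symmetric] by (simp add: algebra_simps)
  also have "\<dots> \<le> (1 - q) * (norm Y)\<^sup>2 + 2 * (1 - q) * ((b - m) / \<alpha>)"
    using q dec \<alpha> by (intro add_left_mono mult_left_mono divide_right_mono) auto
  also have "\<dots> = (1 - q) * ((norm (y - p))\<^sup>2 + 2 * (b - m) / \<alpha>)"
    unfolding Y_def distrib_left by (simp only: times_divide_eq_right mult.assoc mult.left_commute)
  finally show ?thesis
    unfolding eq .
qed

section \<open>Contraction of the potential along the algorithm\<close>

theorem theorem4p1:
  fixes f :: "real ^ 'n \<Rightarrow> real"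
    and \<Psi> :: "real ^ 'n \<Rightarrow> ereal"
    and L \<alpha> :: real
    and xstar :: "real ^ 'n"
    and M :: "nat \<Rightarrow> (real ^ 'n) set"
    and x z y :: "nat \<Rightarrow> real ^ 'n"
  assumes "L > 0" and "\<alpha> > 0"
    and "L_smooth L f" and "strongly_convex \<alpha> f"
    and "closed_fun \<Psi>" and "proper_fun \<Psi>" and "convex_fun \<Psi>"
    and "is_arg_min (composite f \<Psi>) (\<lambda>_. True) xstar"
    and "idealized_algorithm L f \<Psi> xstar M x z y"
  shows "\<forall>k\<ge>1. potential \<alpha> (composite f \<Psi>) xstar x y (k + 1)
                \<le> ereal (1 - sqrt (\<alpha> / L)) * potential \<alpha> (composite f \<Psi>) xstar x y k"
proof (intro allI impI)
  fix k :: nat assume k: "1 \<le> k"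
  define F where "F = composite f \<Psi>"
  define G where "G = prox_grad (1 / L) f \<Psi> (z k)"
  define q where "q = sqrt (\<alpha> / L)"
  define v where "v = z k - (1 / L) *\<^sub>R G"
  note L = \<open>L > 0\<close> and \<alpha> = \<open>\<alpha> > 0\<close>
  have step: "is_arg_min (\<lambda>v. (norm (v - xstar))\<^sup>2) (\<lambda>v. v \<in> M j) (y j) \<and>
      is_arg_min F (\<lambda>v. v \<in> M j) (x j)" if "1 \<le> j" for j
    using assms(9) that by (simp add: idealized_algorithm_def F_def Let_def)
  have algk: "G \<bullet> (y k - z k) \<ge> 0" "F v \<le> F (x k) - ereal (1 / (2 * L) * (norm G)\<^sup>2)"
    and span: "(+) (z k) ` span {y k - z k, G} \<subseteq> M (k + 1)"
    using assms(9) k by (simp_all add: idealized_algorithm_def F_def G_def v_def Let_def)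
  \<comment> \<open>The coefficients \<open>(0, -1/L)\<close> give \<open>v\<close>, and
    \<open>(1 - q, -q/\<alpha>)\<close> give the comparison point for
    \<open>y (k + 1)\<close>.\<close>
  have inM: "z k + s *\<^sub>R (y k - z k) + t *\<^sub>R G \<in> M (k + 1)" for s t
  proof -
    have "s *\<^sub>R (y k - z k) + t *\<^sub>R G \<in> span {y k - z k, G}"
      by (intro span_add span_scale span_base) auto
    then show ?thesis
      using span by (auto simp: add.assoc)
  qed
  have vM: "v \<in> M (k + 1)"
    using inM[of 0 "- (1 / L)"] by (simp add: v_def)
  have ymin: "(norm (y (k + 1) - xstar))\<^sup>2 \<le> (norm (w - xstar))\<^sup>2" if "w \<in> M (k + 1)" for w
    using step[of "k + 1"] that by (simp add: is_arg_min_linorder)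
  have xmin: "F (x (k + 1)) \<le> F v"
    using step[of "k + 1"] vM by (simp add: is_arg_min_linorder)
  obtain c where c: "F v = ereal c"
    and ineq: "\<And>u b. F u = ereal b \<Longrightarrow>
      c + G \<bullet> (u - z k) + (norm G)\<^sup>2 / (2 * L) + \<alpha> / 2 * (norm (u - z k))\<^sup>2 \<le> b"
    using prox_grad_inequality[OF L assms(3-8) G_def] unfolding F_def v_def by blast
  have star: "F xstar \<le> F u" for u
    using assms(8) by (simp add: F_def is_arg_min_linorder)
  have notminf: "F u \<noteq> -\<infinity>" for u
    using \<open>proper_fun \<Psi>\<close> by (cases "\<Psi> u") (auto simp: F_def composite_def proper_fun_def)
  obtain m where m: "F xstar = ereal m"
    using star[of v] notminf[of xstar] c by (cases "F xstar") auto
  obtain d where d: "F (x (k + 1)) = ereal d" and dc: "d \<le> c"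
    using xmin notminf[of "x (k + 1)"] c by (cases "F (x (k + 1))") auto
  have pot: "potential \<alpha> F xstar x y j = ereal ((norm (y j - xstar))\<^sup>2 + 2 * (b - m) / \<alpha>)"
    if "F (x j) = ereal b" for j b
  proof -
    have "2 * ereal (b - m) = ereal (2 * (b - m))"
      by (metis numeral_eq_ereal times_ereal.simps(1))
    then show ?thesis
      using \<alpha> that m by (simp add: potential_def)
  qed
  have le: "\<alpha> \<le> L"
    using assms(3,4) by (rule strong_convexity_le_smoothness)
  have q: "q\<^sup>2 = \<alpha> / L" "0 \<le> q" "q \<le> 1"
    using L \<alpha> le by (auto simp: q_def)
  have "potential \<alpha> F xstar x y (k + 1) \<le> ereal (1 - q) * potential \<alpha> F xstar x y k"
  proof (cases "F (x k)")
    case (real b)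
    let ?w = "z k + (1 - q) *\<^sub>R (y k - z k) - (q / \<alpha>) *\<^sub>R G"
    have "c \<le> b - (norm G)\<^sup>2 / (2 * L)"
      using algk(2) by (simp add: real c)
    from potential_step[OF \<alpha> L q algk(1) ineq[OF m] this]
    have "(norm (?w - xstar))\<^sup>2 + 2 * (c - m) / \<alpha>
        \<le> (1 - q) * ((norm (y k - xstar))\<^sup>2 + 2 * (b - m) / \<alpha>)" .
    moreover have "(norm (y (k + 1) - xstar))\<^sup>2 \<le> (norm (?w - xstar))\<^sup>2"
      using ymin inM[of "1 - q" "- (q / \<alpha>)"] by simp
    moreover have "2 * (d - m) / \<alpha> \<le> 2 * (c - m) / \<alpha>"
      using dc \<alpha> by (intro divide_right_mono) auto
    ultimately show ?thesis
      unfolding pot[OF real] pot[OF d] times_ereal.simps ereal_less_eq by linarith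
  next
    \<comment> \<open>The old potential is infinite here, so the bound is immediate for
      \<open>q < 1\<close>; only \<open>q = 1\<close> needs an argument.\<close>
    case PInf
    then have inf: "potential \<alpha> F xstar x y k = \<infinity>"
      using \<alpha> m by (simp add: potential_def)
    show ?thesis
    proof (cases "q = 1")
      case False
      then show ?thesis
        using q(3) inf by simp
    next
      text \<open>Here \<open>0 * \<infinity> = 0\<close>, so the new potential has to vanish; indeed \<open>\<alpha> = L\<close> makes the
        prox-gradient inequality a lower bound by a square centred at \<open>v\<close>, which forces
        \<open>v = xstar\<close>.\<close>
      case True
      then have "\<alpha> = L"
        using q(1) L by simp
      have "(norm (xstar - v))\<^sup>2 = (norm (xstar - z k))\<^sup>2 + 2 / L * (G \<bullet> (xstar - z k)) + (norm G)\<^sup>2 / L\<^sup>2"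
        unfolding v_def power2_norm_eq_inner
        by (simp add: algebra_simps inner_commute power2_eq_square)
      then have "L / 2 * (norm (xstar - v))\<^sup>2 =
          G \<bullet> (xstar - z k) + (norm G)\<^sup>2 / (2 * L) + \<alpha> / 2 * (norm (xstar - z k))\<^sup>2"
        using L \<open>\<alpha> = L\<close> by (simp add: field_simps power2_eq_square)
      then have "c + L / 2 * (norm (xstar - v))\<^sup>2 \<le> m"
        using ineq[OF m] by linarith
      moreover have "m \<le> c"
        using star[of v] by (simp add: m c)
      ultimately have "c = m" "L / 2 * (norm (xstar - v))\<^sup>2 \<le> 0"
        using L by (smt (verit) mult_nonneg_nonneg zero_le_power2 half_gt_zero)+
      then have "v = xstar"
        using L by (simp add: mult_le_0_iff)
      then have "(norm (y (k + 1) - xstar))\<^sup>2 \<le> 0"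
        using ymin[OF vM] by simp
      moreover have "2 * (d - m) / \<alpha> \<le> 0"
        using dc \<alpha> \<open>c = m\<close> by (simp add: divide_le_0_iff)
      ultimately show ?thesis
        unfolding True pot[OF d] by (simp flip: zero_ereal_def)
    qed
  qed (use notminf in simp)
  then show "potential \<alpha> (composite f \<Psi>) xstar x y (k + 1)
      \<le> ereal (1 - sqrt (\<alpha> / L)) * potential \<alpha> (composite f \<Psi>) xstar x y k"
    by (simp only: F_def q_def)
qed

end
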